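(* Let $\mathcal{C}=((A,\vee,\cdot,0,1),(A,\wedge,\ast,1,0),\alpha)$ be a general coupled semiring and define $$x\rightarrow y:=\alpha(x)\ast y$$ for all $x,y\in A$. Then $$\mathbf{L}(\mathcal{C}):=(A,\vee,\wedge,\cdot,\rightarrow,0,1)$$ is a residuated lattice satisfying the double negation law.
   Context: A residuated lattice is an algebra $\mathcal{L}=(L,\vee,\wedge,\otimes,\rightarrow,0,1)$ of type $(2,2,2,2,0,0)$ such that for all $x,y,z\in L$: (i) $(L,\vee,\wedge,0,1)$ is a bounded lattice (with least element $0$, greatest element $1$ and induced order $\leq$); (ii) $(L,\otimes,1)$ is a commutative monoid; (iii) $x\leq y\rightarrow z$ if and only if $x\otimes y\leq z$. In a residuated lattice put $\neg x:=x\rightarrow 0$. The residuated lattice satisfies the double negation law if $\neg\neg x=x$ for all $x\in L$. A commutative semiring is an algebra $(S,+,\cdot,0,1)$ of type $(2,2,0,0)$ such that for all $x,y,z\in S$: (i) $(S,+,0)$ and $(S,\cdot,1)$ are commutative monoids; (ii) $x(y+z)=xy+xz$; (iii) $x0=0$. In $(A,\wedge,\ast,1,0)$ the addition is $\wedge$ with neutral element $1$, and the multiplication is $\ast$ with neutral element $0$. Homomorphisms and isomorphisms of semirings preserve both operations and both constants, in the listed order. A general coupled semiring is an ordered triple $((A,\vee,\cdot,0,1),(A,\wedge,\ast,1,0),\alpha)$ such that for all $x,y\in A$: (i) $(A,\vee,\cdot,0,1)$ and $(A,\wedge,\ast,1,0)$ are commutative semirings; (ii) $(A,\vee,\wedge)$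 is a lattice (with induced order $\leq$); (iii) $\alpha$ is an isomorphism from $(A,\vee,\cdot,0,1)$ to $(A,\wedge,\ast,1,0)$; (iv) $\alpha(\alpha(x))=x$; (v) $x\leq y$ if and only if $\alpha(x)\ast y=1$. *)

theory Defs
  imports "HOL-Algebra.QuotRing"
begin

text \<open>Lattices are taken algebraically, as sets with two operations; the induced order is
  \<open>x \<le> y \<longleftrightarrow> vee x y = y\<close>, equivalently \<open>wedge x y = x\<close>.\<close>

locale algebraic_lattice =
  fixes A :: "'a set" and vee :: "'a \<Rightarrow> 'a \<Rightarrow> 'a" and wedge :: "'a \<Rightarrow> 'a \<Rightarrow> 'a"
  assumes sup_closed: "\<lbrakk>x \<in> A; y \<in> A\<rbrakk> \<Longrightarrow> vee x y \<in> A"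
    and inf_closed: "\<lbrakk>x \<in> A; y \<in> A\<rbrakk> \<Longrightarrow> wedge x y \<in> A"
    and sup_comm: "\<lbrakk>x \<in> A; y \<in> A\<rbrakk> \<Longrightarrow> vee x y = vee y x"
    and inf_comm: "\<lbrakk>x \<in> A; y \<in> A\<rbrakk> \<Longrightarrow> wedge x y = wedge y x"
    and sup_assoc: "\<lbrakk>x \<in> A; y \<in> A; z \<in> A\<rbrakk> \<Longrightarrow> vee (vee x y) z = vee x (vee y z)"
    and inf_assoc: "\<lbrakk>x \<in> A; y \<in> A; z \<in> A\<rbrakk> \<Longrightarrow> wedge (wedge x y) z = wedge x (wedge y z)"
    and sup_inf_absorb: "\<lbrakk>x \<in> A; y \<in> A\<rbrakk> \<Longrightarrow> vee x (wedge x y) = x"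
    and inf_sup_absorb: "\<lbrakk>x \<in> A; y \<in> A\<rbrakk> \<Longrightarrow> wedge x (vee x y) = x"

definition induced_le :: "('a \<Rightarrow> 'a \<Rightarrow> 'a) \<Rightarrow> 'a \<Rightarrow> 'a \<Rightarrow> bool"
  where "induced_le vee x y \<longleftrightarrow> vee x y = y"

text \<open>The fields \<open>mult\<close> and \<open>one\<close> inherited from \<open>monoid\<close> are the monoid operation and the
  greatest element of a residuated lattice.\<close>

record 'a residuated = "'a monoid" +
  lsup :: "'a \<Rightarrow> 'a \<Rightarrow> 'a"
  linf :: "'a \<Rightarrow> 'a \<Rightarrow> 'a"
  residuum :: "'a \<Rightarrow> 'a \<Rightarrow> 'a" (infixr \<open>\<hookrightarrow>\<index>\<close> 60)
  lbot :: 'a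

locale residuated_lattice =
  algebraic_lattice "carrier L" "lsup L" "linf L" + comm_monoid L
  for L (structure) +
  assumes bot_closed: "lbot L \<in> carrier L"
    and residuum_closed: "\<lbrakk>x \<in> carrier L; y \<in> carrier L\<rbrakk> \<Longrightarrow> x \<hookrightarrow> y \<in> carrier L"
    and bot_least: "x \<in> carrier L \<Longrightarrow> induced_le (lsup L) (lbot L) x"
    and one_greatest: "x \<in> carrier L \<Longrightarrow> induced_le (lsup L) x \<one>"
    and adjointness: "\<lbrakk>x \<in> carrier L; y \<in> carrier L; z \<in> carrier L\<rbrakk> \<Longrightarrow>
      induced_le (lsup L) x (y \<hookrightarrow> z) \<longleftrightarrow> induced_le (lsup L) (x \<otimes> y) z"

definition lneg :: "('a, 'b) residuated_scheme \<Rightarrow> 'a \<Rightarrow> 'a"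
  where "lneg L x = residuum L x (lbot L)"

definition double_negation_law :: "('a, 'b) residuated_scheme \<Rightarrow> bool"
  where "double_negation_law L \<longleftrightarrow> (\<forall>x \<in> carrier L. lneg L (lneg L x) = x)"

locale commutative_semiring = semiring R + comm_monoid R for R (structure)

text \<open>\<open>ring_iso\<close> does not require preservation of \<open>\<zero>\<close>, which is not automatic for semirings.\<close>

definition semiring_iso :: "('a, 'c) ring_scheme \<Rightarrow> ('b, 'd) ring_scheme \<Rightarrow> ('a \<Rightarrow> 'b) set"
  where "semiring_iso R S = {h \<in> ring_iso R S. h \<zero>\<^bsub>R\<^esub> = \<zero>\<^bsub>S\<^esub>}"

text \<open>\<open>S\<close> stands for \<open>(A, \<or>, \<cdot>, 0, 1)\<close> and \<open>T\<close> for \<open>(A, \<and>, *, 1, 0)\<close>. Hence join and meet are the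
  additions of \<open>S\<close> and \<open>T\<close>, and \<open>T\<close> has the two constants of \<open>S\<close> interchanged.\<close>

locale general_coupled_semiring =
  S: commutative_semiring S + T: commutative_semiring T +
  algebraic_lattice "carrier S" "add S" "add T"
  for S :: "'a ring" and T :: "'a ring" and \<alpha> :: "'a \<Rightarrow> 'a" +
  assumes carrier_eq: "carrier T = carrier S"
    and zero_T: "\<zero>\<^bsub>T\<^esub> = \<one>\<^bsub>S\<^esub>"
    and one_T: "\<one>\<^bsub>T\<^esub> = \<zero>\<^bsub>S\<^esub>"
    and iso: "\<alpha> \<in> semiring_iso S T"
    and involution: "x \<in> carrier S \<Longrightarrow> \<alpha> (\<alpha> x) = x"
    and le_iff: "\<lbrakk>x \<in> carrier S; y \<in> carrier S\<rbrakk> \<Longrightarrow>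
      induced_le (add S) x y \<longleftrightarrow> \<alpha> x \<otimes>\<^bsub>T\<^esub> y = \<one>\<^bsub>S\<^esub>"

definition residuated_of_coupled :: "'a ring \<Rightarrow> 'a ring \<Rightarrow> ('a \<Rightarrow> 'a) \<Rightarrow> 'a residuated"
  where "residuated_of_coupled S T \<alpha> =
    \<lparr>carrier = carrier S, mult = mult S, one = \<one>\<^bsub>S\<^esub>,
     lsup = add S, linf = add T, residuum = (\<lambda>x y. \<alpha> x \<otimes>\<^bsub>T\<^esub> y), lbot = \<zero>\<^bsub>S\<^esub>\<rparr>"

end

theory Submission
  imports Defs
begin

text \<open>The axiom \<open>x \<le> y \<longleftrightarrow> \<alpha> x * y = 1\<close> of a coupled semiring turns inequalities into equations in
  the second semiring, and there adjointness becomes associativity: since \<open>\<alpha>\<close> carries \<open>\<cdot>\<close> to \<open>*\<close>,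
  \<open>x \<le> y \<rightarrow> z\<close> says \<open>\<alpha> x * (\<alpha> y * z) = 1\<close>, while \<open>x \<cdot> y \<le> z\<close> says \<open>(\<alpha> x * \<alpha> y) * z = 1\<close>.
  The bounds hold because \<open>0\<close> and \<open>1\<close> are the neutral elements of join and meet. Finally \<open>0\<close> is
  neutral for \<open>*\<close>, so negation is \<open>\<alpha>\<close> itself, and double negation is the involution law.\<close>

context general_coupled_semiring
begin

lemma alpha_closed: "x \<in> carrier S \<Longrightarrow> \<alpha> x \<in> carrier S"
  using iso carrier_eq by (auto simp: semiring_iso_def ring_iso_def dest: ring_hom_closed)

lemma alpha_mult:
  "\<lbrakk>x \<in> carrier S; y \<in> carrier S\<rbrakk> \<Longrightarrow> \<alpha> (x \<otimes>\<^bsub>S\<^esub> y) = \<alpha> x \<otimes>\<^bsub>T\<^esub> \<alpha> y"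
  using iso by (auto simp: semiring_iso_def ring_iso_def dest: ring_hom_mult)

lemma multT_closed: "\<lbrakk>x \<in> carrier S; y \<in> carrier S\<rbrakk> \<Longrightarrow> x \<otimes>\<^bsub>T\<^esub> y \<in> carrier S"
  using T.m_closed by (simp add: carrier_eq)

lemma zero_least: "x \<in> carrier S \<Longrightarrow> induced_le (add S) \<zero>\<^bsub>S\<^esub> x"
  by (simp add: induced_le_def)

text \<open>As \<open>1\<close> is neutral for meet, the absorption law \<open>1 \<or> (1 \<and> x) = 1\<close> reads \<open>1 \<or> x = 1\<close>.\<close>

lemma one_greatest:
  assumes "x \<in> carrier S"
  shows "induced_le (add S) x \<one>\<^bsub>S\<^esub>"
proof -
  have "\<one>\<^bsub>S\<^esub> \<oplus>\<^bsub>T\<^esub> x = x"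
    using T.l_zero[of x] assms by (simp add: carrier_eq zero_T)
  then have "\<one>\<^bsub>S\<^esub> \<oplus>\<^bsub>S\<^esub> x = \<one>\<^bsub>S\<^esub>"
    using sup_inf_absorb[of "\<one>\<^bsub>S\<^esub>" x] assms by simp
  then show ?thesis
    using sup_comm[of x "\<one>\<^bsub>S\<^esub>"] assms by (simp add: induced_le_def)
qed

lemma residuation:
  assumes "x \<in> carrier S" "y \<in> carrier S" "z \<in> carrier S"
  shows "induced_le (add S) x (\<alpha> y \<otimes>\<^bsub>T\<^esub> z) \<longleftrightarrow> induced_le (add S) (x \<otimes>\<^bsub>S\<^esub> y) z"
proof -
  have "induced_le (add S) x (\<alpha> y \<otimes>\<^bsub>T\<^esub> z) \<longleftrightarrow> \<alpha> x \<otimes>\<^bsub>T\<^esub> (\<alpha> y \<otimes>\<^bsub>T\<^esub> z) = \<one>\<^bsub>S\<^esub>"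
    using assms by (simp add: le_iff alpha_closed multT_closed)
  also have "\<alpha> x \<otimes>\<^bsub>T\<^esub> (\<alpha> y \<otimes>\<^bsub>T\<^esub> z) = \<alpha> (x \<otimes>\<^bsub>S\<^esub> y) \<otimes>\<^bsub>T\<^esub> z"
    using assms T.m_assoc[of "\<alpha> x" "\<alpha> y" z] by (simp add: alpha_mult alpha_closed carrier_eq)
  also have "\<dots> = \<one>\<^bsub>S\<^esub> \<longleftrightarrow> induced_le (add S) (x \<otimes>\<^bsub>S\<^esub> y) z"
    using assms by (simp add: le_iff)
  finally show ?thesis .
qed

lemma multT_zero: "x \<in> carrier S \<Longrightarrow> x \<otimes>\<^bsub>T\<^esub> \<zero>\<^bsub>S\<^esub> = x"
  using T.r_one[of x] by (simp add: carrier_eq one_T)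

lemma residuated_lattice_of_coupled: "residuated_lattice (residuated_of_coupled S T \<alpha>)"
proof -
  let ?L = "residuated_of_coupled S T \<alpha>"
  have "algebraic_lattice (carrier ?L) (lsup ?L) (linf ?L)"
    using algebraic_lattice_axioms by (simp add: residuated_of_coupled_def)
  moreover have "comm_monoid ?L"
    by (rule comm_monoidI) (auto simp: residuated_of_coupled_def S.m_assoc intro: S.m_comm)
  moreover have "residuated_lattice_axioms ?L"
    by unfold_locales
      (simp_all add: residuated_of_coupled_def alpha_closed multT_closed zero_least one_greatest
        residuation)
  ultimately show ?thesis
    by (rule residuated_lattice.intro)
qed

lemma double_negation_of_coupled: "double_negation_law (residuated_of_coupled S T \<alpha>)"
  by (simp add: double_negation_law_def lneg_def residuated_of_coupled_def multT_zero
      alpha_closed involution)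

end

theorem theorem11:
  fixes S T :: "'a ring" and \<alpha> :: "'a \<Rightarrow> 'a"
  assumes "general_coupled_semiring S T \<alpha>"
  shows "residuated_lattice (residuated_of_coupled S T \<alpha>) \<and>
    double_negation_law (residuated_of_coupled S T \<alpha>)"
  using general_coupled_semiring.residuated_lattice_of_coupled[OF assms]
    general_coupled_semiring.double_negation_of_coupled[OF assms] by (rule conjI)

end
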